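(* No edge-based fixed-orientation algorithm guarantees any positive approximation for Pandora's Matching Problem: for every edge-based fixed-orientation algorithm $\textsc{Alg}$ and every $\alpha>0$ there exists an instance on which $\mathrm{Welfare}(\textsc{Alg})<\alpha\,\mathrm{Welfare}(\textsc{Opt})$.
   Context: Pandora's Matching Problem. An instance consists of a finite undirected graph $G=(V,E)$, not necessarily bipartite, and, for each edge $\{i,j\}\in E$, two Pandora boxes: box $(i,j)$ with a known distribution $D_{ij}$ over $\mathbb{R}$ (with finite mean) and a known cost $c_{ij}\ge 0$, and box $(j,i)$ with $D_{ji}$ and $c_{ji}\ge 0$. The values $v_{ij}\sim D_{ij}$ are drawn independently over all boxes. An algorithm repeatedly chooses an unopened box $(i,j)$, pays $c_{ij}$ and observes $v_{ij}$; its choices may depend on everything observed so far. Eventually it stops and outputs a matching of $G$ consisting only of edges both of whose boxes have been opened. Let $\mathbb{I}_{ij}$ indicate that box $(i,j)$ was opened and $\mathbb{A}_{ij}=\mathbb{A}_{ji}$ indicate that $\{i,j\}$ is in the output matching. The welfare of an algorithm is $\mathrm{Welfare}=\mathbb{E}\big[\sum_{(i,j)}(\mathbb{A}_{ij}v_{ij}-\mathbb{I}_{ij}c_{ij})\big]$, the sum over all boxes. $\textsc{Opt}$ denotes a welfare-maximizing algorithm. An algorithm guarantees approximation factor $\alpha$ if $\mathrm{Welfare}(\textsc{Alg})\ge\alpha\,\mathrm{Welfare}(\textsc{Opt})$ on every instance. An orientation $\mathcal{O}$ of $G$ is a set of ordered pairs containing, for each edge $\{i,j\}$, exactly one of $(i,j)$,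 $(j,i)$. An algorithm is $\mathcal{O}$-oriented if for every $(i,j)\in\mathcal{O}$, box $(j,i)$ is opened only if box $(i,j)$ was opened before it. An edge-based fixed-orientation algorithm is one that, given an instance, constructs an orientation $\mathcal{O}$ by applying a deterministic rule to each edge $\{i,j\}$ that depends only on that edge's parameters $D_{ij},c_{ij},D_{ji},c_{ji}$, and then runs some $\mathcal{O}$-oriented algorithm. *)

theory Defs
  imports "HOL-Probability.Probability"
begin

text \<open>
  Vertices are natural numbers; every finite graph has an isomorphic copy of this form.  The
  entries \<open>box_dist\<close> and \<open>box_cost\<close> only matter on the boxes, i.e. on the ordered pairs \<open>(i, j)\<close> with
  \<open>{i, j}\<close> an edge.
\<close>

record pandora =
  verts :: "nat set"
  edges :: "nat set set"
  box_dist :: "nat \<times> nat \<Rightarrow> real measure"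
  box_cost :: "nat \<times> nat \<Rightarrow> real"

definition boxes :: "pandora \<Rightarrow> (nat \<times> nat) set" where
  "boxes I = {(i, j). {i, j} \<in> edges I}"

definition pandora_instance :: "pandora \<Rightarrow> bool" where
  "pandora_instance I \<longleftrightarrow>
     finite (verts I) \<and>
     (\<forall>e\<in>edges I. e \<subseteq> verts I \<and> card e = 2) \<and>
     (\<forall>b\<in>boxes I. prob_space (box_dist I b) \<and> sets (box_dist I b) = sets borel \<and>
        integrable (box_dist I b) (\<lambda>x. x) \<and> 0 \<le> box_cost I b)"

definition value_space :: "pandora \<Rightarrow> (nat \<times> nat \<Rightarrow> real) measure" where
  "value_space I = PiM (boxes I) (box_dist I)"

definition matching :: "pandora \<Rightarrow> nat set set \<Rightarrow> bool" where
  "matching I M \<longleftrightarrow> M \<subseteq> edges I \<and> pairwise disjnt M"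

text \<open>
  An adaptive algorithm on a fixed instance is a decision tree: either stop and output a set of
  edges, or open a box and continue with a tree depending on the observed value.  A node of the
  tree thus knows all boxes opened on the way to it and all values found there.
\<close>

datatype policy = Stop "nat set set" | Open "nat \<times> nat" "real \<Rightarrow> policy"

primrec opened :: "policy \<Rightarrow> (nat \<times> nat \<Rightarrow> real) \<Rightarrow> (nat \<times> nat) set" where
  "opened (Stop M) v = {}"
| "opened (Open b k) v = insert b (opened (k (v b)) v)"

primrec outcome :: "policy \<Rightarrow> (nat \<times> nat \<Rightarrow> real) \<Rightarrow> nat set set" where
  "outcome (Stop M) v = M"
| "outcome (Open b k) v = outcome (k (v b)) v"

text \<open>In the next two functions, \<open>S\<close> is the set of boxes that have already been opened.\<close>

primrec feasible :: "pandora \<Rightarrow> (nat \<times> nat) set \<Rightarrow> policy \<Rightarrow> bool" where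
  "feasible I S (Stop M) \<longleftrightarrow> matching I M \<and> (\<forall>i j. {i, j} \<in> M \<longrightarrow> (i, j) \<in> S \<and> (j, i) \<in> S)"
| "feasible I S (Open b k) \<longleftrightarrow> b \<in> boxes I \<and> b \<notin> S \<and> (\<forall>x. feasible I (insert b S) (k x))"

primrec oriented :: "(nat \<times> nat) set \<Rightarrow> (nat \<times> nat) set \<Rightarrow> policy \<Rightarrow> bool" where
  "oriented R S (Stop M) \<longleftrightarrow> True"
| "oriented R S (Open b k) \<longleftrightarrow>
     ((snd b, fst b) \<in> R \<longrightarrow> (snd b, fst b) \<in> S) \<and> (\<forall>x. oriented R (insert b S) (k x))"

text \<open>
  The indicators of ``box \<open>b\<close> is opened'' and ``edge \<open>e\<close> is matched'' have to be random
  variables, as otherwise the welfare of the algorithm is not defined.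
\<close>

definition algorithm :: "pandora \<Rightarrow> policy \<Rightarrow> bool" where
  "algorithm I p \<longleftrightarrow>
     feasible I {} p \<and>
     (\<forall>b\<in>boxes I. Measurable.pred (value_space I) (\<lambda>v. b \<in> opened p v)) \<and>
     (\<forall>e\<in>edges I. Measurable.pred (value_space I) (\<lambda>v. e \<in> outcome p v))"

definition welfare :: "pandora \<Rightarrow> policy \<Rightarrow> real" where
  "welfare I p = (\<integral>v. (\<Sum>(i, j)\<in>boxes I.
       of_bool ({i, j} \<in> outcome p v) * v (i, j)
       - of_bool ((i, j) \<in> opened p v) * box_cost I (i, j)) \<partial>value_space I)"

definition optimal :: "pandora \<Rightarrow> policy \<Rightarrow> bool" where
  "optimal I p \<longleftrightarrow> algorithm I p \<and> (\<forall>q. algorithm I q \<longrightarrow> welfare I q \<le> welfare I p)"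

definition orientation :: "pandora \<Rightarrow> (nat \<times> nat) set \<Rightarrow> bool" where
  "orientation I R \<longleftrightarrow> R \<subseteq> boxes I \<and> (\<forall>(i, j)\<in>boxes I. (i, j) \<in> R \<longleftrightarrow> (j, i) \<notin> R)"

text \<open>
  An edge rule takes the parameters \<open>D\<^sub>i\<^sub>j, c\<^sub>i\<^sub>j, D\<^sub>j\<^sub>i, c\<^sub>j\<^sub>i\<close> and says whether \<open>(i, j)\<close> (rather than
  \<open>(j, i)\<close>) belongs to the orientation.  If the two boxes of an edge have the same parameters, no
  such rule can tell them apart, and either direction of this edge is accepted.
\<close>

type_synonym edge_rule = "real measure \<Rightarrow> real \<Rightarrow> real measure \<Rightarrow> real \<Rightarrow> bool"

definition obeys_rule :: "edge_rule \<Rightarrow> pandora \<Rightarrow> (nat \<times> nat) set \<Rightarrow> bool" where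
  "obeys_rule rule I R \<longleftrightarrow>
     (\<forall>(i, j)\<in>boxes I. (box_dist I (i, j), box_cost I (i, j)) \<noteq> (box_dist I (j, i), box_cost I (j, i)) \<longrightarrow>
        ((i, j) \<in> R \<longleftrightarrow> rule (box_dist I (i, j)) (box_cost I (i, j)) (box_dist I (j, i)) (box_cost I (j, i))))"

definition edge_based_fixed_orientation :: "(pandora \<Rightarrow> policy) \<Rightarrow> bool" where
  "edge_based_fixed_orientation alg \<longleftrightarrow>
     (\<exists>rule. \<forall>I. pandora_instance I \<longrightarrow>
        algorithm I (alg I) \<and>
        (\<exists>R. orientation I R \<and> obeys_rule rule I R \<and> oriented R {} (alg I)))"

end

theory Submission imports Defs begin

text \<open>
  Consider a star with \<open>n\<close> leaves.  At every edge, the \<^emph>\<open>prize\<close> box \<open>(0, i)\<close> holds \<open>1 / p\<close> with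
  probability \<open>p\<close> and \<open>0\<close> otherwise, and costs \<open>(1 - \<delta>) / 2\<close>; the \<^emph>\<open>veto\<close> box \<open>(i, 0)\<close> holds \<open>1\<close> or the
  prohibitive value \<open>- 1 / p\<close> with equal probability, and costs \<open>1 / 2\<close>.  An edge rule must direct all
  edges of all these stars alike.

  \<^item> Prize first: since half of the prizes are vetoed, each prize box yields only \<open>\<delta> / 2\<close> net of
    costs.  On a single edge this loses against opening the veto box first, which saves the cost
    of the prize box in half of the cases and earns \<open>(1 + \<delta>) / 4\<close>.
  \<^item> Veto first: finding a prize takes about \<open>1 / p\<close> trials, each of which now costs an additional
    \<open>1 / 2\<close>, so that the welfare is at most \<open>1\<close> for every \<open>n\<close>.  Opening prize boxes until a prize is
    found, and only then its veto box, earns \<open>\<delta> / (2 p)\<close> in the limit of large \<open>n\<close>.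

  Both ratios are arbitrarily small for \<open>\<delta> \<rightarrow> 0\<close> and \<open>p / \<delta> \<rightarrow> 0\<close>.
\<close>

section \<open>Instances with finitely supported values\<close>

definition payoff :: "pandora \<Rightarrow> policy \<Rightarrow> (nat \<times> nat \<Rightarrow> real) \<Rightarrow> real" where
  "payoff I p v = (\<Sum>(i, j)\<in>boxes I.
       of_bool ({i, j} \<in> outcome p v) * v (i, j)
       - of_bool ((i, j) \<in> opened p v) * box_cost I (i, j))"

text \<open>Here \<open>u\<close> records the values observed so far; elsewhere it is irrelevant.\<close>

primrec policy_value ::
    "pandora \<Rightarrow> (nat \<times> nat \<Rightarrow> real pmf) \<Rightarrow> policy \<Rightarrow> (nat \<times> nat \<Rightarrow> real) \<Rightarrow> real" where
  "policy_value I P (Stop M) u = (\<Sum>(i, j)\<in>boxes I. of_bool ({i, j} \<in> M) * u (i, j))"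
| "policy_value I P (Open b k) u =
     measure_pmf.expectation (P b) (\<lambda>x. policy_value I P (k x) (u(b := x))) - box_cost I b"

text \<open>A test against one value keeps measurability inductive: only two subtrees occur, whereas
  a general \<open>Open\<close> node has one for every real number.\<close>

definition branch :: "nat \<times> nat \<Rightarrow> real \<Rightarrow> policy \<Rightarrow> policy \<Rightarrow> policy" where
  "branch b t p q = Open b (\<lambda>x. if x = t then p else q)"

definition measurable_policy :: "pandora \<Rightarrow> policy \<Rightarrow> bool" where
  "measurable_policy I p \<longleftrightarrow>
     (\<forall>b\<in>boxes I. Measurable.pred (value_space I) (\<lambda>v. b \<in> opened p v)) \<and>
     (\<forall>e\<in>edges I. Measurable.pred (value_space I) (\<lambda>v. e \<in> outcome p v))"

lemma algorithm_iff: "algorithm I p \<longleftrightarrow> feasible I {} p \<and> measurable_policy I p"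
  by (simp add: algorithm_def measurable_policy_def)

text \<open>By independence, replacing coordinate \<open>b\<close> by a fresh draw preserves the
  distribution. The full product stays on the right, so that an induction over a decision tree keeps
  the index set fixed.\<close>

lemma expectation_Pi_pmf_resample:
  fixes h :: "('a \<Rightarrow> 'b) \<Rightarrow> real"
  assumes "finite B" "b \<in> B" and fin: "\<And>c. c \<in> B \<Longrightarrow> finite (set_pmf (P c))"
  shows "measure_pmf.expectation (Pi_pmf B d P) h =
    measure_pmf.expectation (P b)
      (\<lambda>x. measure_pmf.expectation (Pi_pmf B d P) (\<lambda>v. h (v(b := x))))"
proof -
  define B' where "B' = B - {b}"
  have B: "B = insert b B'" "b \<notin> B'" "finite B'"
    using assms by (auto simp: B'_def)
  let ?Q = "Pi_pmf B' d P"
  have Pi: "Pi_pmf B d P = bind_pmf (P b) (\<lambda>x. map_pmf (\<lambda>v. v(b := x)) ?Q)"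
    unfolding B(1) Pi_pmf_insert[OF B(3,2)]
    by (simp add: pair_pmf_def map_pmf_def bind_assoc_pmf bind_return_pmf)
  have Q: "finite (set_pmf ?Q)"
    using B fin by (auto simp: set_Pi_pmf)
  have E: "measure_pmf.expectation (Pi_pmf B d P) g =
      measure_pmf.expectation (P b) (\<lambda>x. measure_pmf.expectation ?Q (\<lambda>v. g (v(b := x))))"
    for g :: "('a \<Rightarrow> 'b) \<Rightarrow> real"
    unfolding Pi using fin assms(2) Q
    by (subst pmf_expectation_bind[where A = "set_pmf (P b)"])
       (auto simp: integral_measure_pmf[where A = "set_pmf (P b)"])
  \<comment> \<open>The value at \<open>b\<close> is overwritten, so the outer expectation in
    \<open>E\<close> is that of a constant.\<close>
  have "measure_pmf.expectation (Pi_pmf B d P) (\<lambda>v. h (v(b := x))) =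
      measure_pmf.expectation ?Q (\<lambda>v. h (v(b := x)))" for x
    by (subst E) simp
  then show ?thesis
    by (simp add: E)
qed

lemma opened_disjoint: "feasible I S p \<Longrightarrow> opened p v \<subseteq> boxes I - S"
proof (induction p arbitrary: S)
  case (Open b k)
  then have "opened (k (v b)) v \<subseteq> boxes I - insert b S"
    by simp
  then show ?case
    using Open.prems by auto
qed simp

lemma outcome_subset_edges: "feasible I S p \<Longrightarrow> outcome p v \<subseteq> edges I"
  by (induction p arbitrary: S) (auto simp: matching_def)

section \<open>Welfare as a finite expectation\<close>

text \<open>The \<open>distr\<close> moves a pmf, whose sigma-algebra is discrete, to the Borel sets
  that an instance demands.\<close>

locale discrete_pandora =
  fixes I :: pandora and P :: "nat \<times> nat \<Rightarrow> real pmf"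
  assumes instance_I: "pandora_instance I"
    and box_dist_eq: "\<And>b. b \<in> boxes I \<Longrightarrow> box_dist I b = distr (measure_pmf (P b)) borel (\<lambda>x. x)"
    and finite_support: "\<And>b. b \<in> boxes I \<Longrightarrow> finite (set_pmf (P b))"
begin

text \<open>The default \<open>undefined\<close> matches the extensional functions of
  \<open>PiM\<close>, so that \<open>restrict\<close> is the identity on the support.\<close>

abbreviation V :: "(nat \<times> nat \<Rightarrow> real) pmf" where
  "V \<equiv> Pi_pmf (boxes I) undefined P"

lemma finite_boxes: "finite (boxes I)"
proof (rule finite_subset)
  show "boxes I \<subseteq> verts I \<times> verts I"
    using instance_I by (auto simp: boxes_def pandora_instance_def)
  show "finite (verts I \<times> verts I)"
    using instance_I by (simp add: pandora_instance_def)
qed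

lemma finite_edges: "finite (edges I)"
  by (rule finite_subset[of _ "Pow (verts I)"])
     (use instance_I in \<open>auto simp: pandora_instance_def\<close>)

lemma finite_set_V: "finite (set_pmf V)"
  using finite_boxes finite_support by (auto simp: set_Pi_pmf)

lemma value_space_eq_distr:
  "value_space I = distr V (value_space I) (\<lambda>v. restrict v (boxes I))"
proof -
  \<comment> \<open>\<open>box_dist I\<close> is unconstrained outside \<open>boxes I\<close>; this
    family consists of probability measures everywhere, as \<open>product_prob_space\<close>
    requires.\<close>
  let ?M = "\<lambda>b. distr (measure_pmf (P b)) borel (\<lambda>x::real. x)"
  let ?f = "\<lambda>v. restrict v (boxes I)"
  have prob: "prob_space (?M b)" for b
    by (rule prob_space.prob_space_distr) (auto intro: measure_pmf.prob_space_axioms)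
  interpret product_prob_space ?M "boxes I"
    by (simp add: product_prob_space_def product_prob_space_axioms_def prob
        product_sigma_finite_def prob_space_imp_sigma_finite)
  have vs: "value_space I = PiM (boxes I) ?M"
    unfolding value_space_def by (rule PiM_cong) (simp_all add: box_dist_eq)
  have m: "?f \<in> measurable V (PiM (boxes I) ?M)"
    by (auto simp: space_PiM)
  have "distr V (PiM (boxes I) ?M) ?f = PiM (boxes I) ?M"
  proof (rule PiM_eqI[OF finite_boxes])
    fix A assume A: "\<And>b. b \<in> boxes I \<Longrightarrow> A b \<in> sets (?M b)"
    have "emeasure (distr V (PiM (boxes I) ?M) ?f) (Pi\<^sub>E (boxes I) A) =
        emeasure V (?f -` Pi\<^sub>E (boxes I) A)"
      using A by (subst emeasure_distr[OF m]) (auto intro!: sets_PiM_I_finite finite_boxes)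
    also have "?f -` Pi\<^sub>E (boxes I) A = Pi (boxes I) A"
      by auto
    also have "emeasure V \<dots> = (\<Prod>b\<in>boxes I. emeasure (P b) (A b))"
      by (simp add: measure_pmf.emeasure_eq_measure measure_Pi_pmf_Pi finite_boxes prod_ennreal)
    also have "\<dots> = (\<Prod>b\<in>boxes I. emeasure (?M b) (A b))"
      using A by (intro prod.cong refl) (auto simp: emeasure_distr)
    finally show "emeasure (distr V (PiM (boxes I) ?M) ?f) (Pi\<^sub>E (boxes I) A) =
        (\<Prod>b\<in>boxes I. emeasure (?M b) (A b))" .
  qed simp
  then show ?thesis
    by (simp add: vs)
qed

lemma measurable_component_value_space [measurable]:
  "b \<in> boxes I \<Longrightarrow> (\<lambda>v. v b) \<in> borel_measurable (value_space I)"
proof -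
  assume b: "b \<in> boxes I"
  then have "(\<lambda>v. v b) \<in> measurable (value_space I) (box_dist I b)"
    unfolding value_space_def by (rule measurable_component_singleton)
  moreover have "sets (box_dist I b) = sets borel"
    using b by (simp add: box_dist_eq)
  ultimately show ?thesis
    using measurable_cong_sets by blast
qed

lemma borel_measurable_payoff:
  assumes "measurable_policy I p"
  shows "payoff I p \<in> borel_measurable (value_space I)"
  unfolding payoff_def
proof (intro borel_measurable_sum)
  fix b assume b: "b \<in> boxes I"
  obtain i j where ij: "b = (i, j)"
    by (cases b)
  have [measurable]: "Measurable.pred (value_space I) (\<lambda>v. {i, j} \<in> outcome p v)"
      "Measurable.pred (value_space I) (\<lambda>v. (i, j) \<in> opened p v)"
    using assms b by (auto simp: measurable_policy_def boxes_def ij)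
  have [measurable]: "(\<lambda>v. v (i, j)) \<in> borel_measurable (value_space I)"
    using b ij measurable_component_value_space by simp
  show "(\<lambda>v. case b of (i, j) \<Rightarrow> of_bool ({i, j} \<in> outcome p v) * v (i, j)
      - of_bool ((i, j) \<in> opened p v) * box_cost I (i, j)) \<in> borel_measurable (value_space I)"
    unfolding ij prod.case by measurable
qed

lemma welfare_eq_expectation:
  assumes "algorithm I p"
  shows "welfare I p = measure_pmf.expectation V (payoff I p)"
proof -
  have meas: "payoff I p \<in> borel_measurable (value_space I)"
    using assms by (simp add: algorithm_iff borel_measurable_payoff)
  have m: "(\<lambda>v. restrict v (boxes I)) \<in> measurable V (value_space I)"
    using box_dist_eq by (auto simp: value_space_def space_PiM)
  have "welfare I p = (\<integral>v. payoff I p v \<partial>value_space I)"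
    by (simp add: welfare_def payoff_def)
  also have "\<dots> = measure_pmf.expectation V (\<lambda>v. payoff I p (restrict v (boxes I)))"
    by (subst value_space_eq_distr, rule integral_distr[OF m meas])
  also have "\<dots> = measure_pmf.expectation V (payoff I p)"
  proof (rule integral_cong_AE)
    have "restrict v (boxes I) = v" if "v \<in> set_pmf V" for v
      using that finite_boxes by (auto simp: set_Pi_pmf PiE_dflt_def restrict_def fun_eq_iff)
    then show "AE v in V. payoff I p (restrict v (boxes I)) = payoff I p v"
      by (simp add: AE_measure_pmf_iff)
  qed auto
  finally show ?thesis .
qed

lemma payoff_Open:
  assumes "b \<in> boxes I" "b \<notin> opened (k (v b)) v"
  shows "payoff I (Open b k) v = payoff I (k (v b)) v - box_cost I b"
proof -
  have "payoff I (Open b k) v = (\<Sum>c\<in>boxes I. (case c of (i, j) \<Rightarrow>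
         of_bool ({i, j} \<in> outcome (k (v b)) v) * v (i, j)
         - of_bool ((i, j) \<in> opened (k (v b)) v) * box_cost I (i, j))
       - (if c = b then box_cost I b else 0))"
    unfolding payoff_def using assms by (intro sum.cong refl) auto
  then show ?thesis
    using assms finite_boxes by (simp add: sum_subtractf payoff_def)
qed

text \<open>\<open>override_on v u S\<close> freezes the observed values and leaves the others
  random. Opening \<open>b\<close> freezes one more coordinate, which is the resampling identity;
  its cost splits off because no box is opened twice.\<close>

lemma expectation_payoff:
  assumes "feasible I S p"
  shows "measure_pmf.expectation V (\<lambda>v. payoff I p (override_on v u S)) = policy_value I P p u"
  using assms
proof (induction p arbitrary: S u)
  case (Stop M)
  have "payoff I (Stop M) (override_on v u S) = policy_value I P (Stop M) u" for v
    unfolding payoff_def policy_value.simps using Stop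
    by (intro sum.cong refl) auto
  then show ?case
    by simp
next
  case (Open b k)
  then have b: "b \<in> boxes I" "b \<notin> S" and k: "\<And>x. feasible I (insert b S) (k x)"
    by auto
  have upd: "override_on (v(b := x)) u S = override_on v (u(b := x)) (insert b S)" for v x
    using b by (auto simp: override_on_def)
  have "payoff I (Open b k) (override_on v (u(b := x)) (insert b S)) =
      payoff I (k x) (override_on v (u(b := x)) (insert b S)) - box_cost I b" for v x
    using b opened_disjoint[OF k] by (subst payoff_Open) auto
  then have "measure_pmf.expectation V (\<lambda>v. payoff I (Open b k) (override_on v u S)) =
     measure_pmf.expectation (P b) (\<lambda>x. measure_pmf.expectation V
       (\<lambda>v. payoff I (k x) (override_on v (u(b := x)) (insert b S)) - box_cost I b))"
    by (subst expectation_Pi_pmf_resample[OF finite_boxes b(1) finite_support])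
       (auto simp: upd)
  also have "\<dots> = measure_pmf.expectation (P b)
      (\<lambda>x. policy_value I P (k x) (u(b := x)) - box_cost I b)"
    by (simp add: integrable_measure_pmf_finite finite_set_V Open.IH[OF rangeI k] fun_upd_def)
  also have "\<dots> = policy_value I P (Open b k) u"
    by (simp add: integrable_measure_pmf_finite finite_support b)
  finally show ?case .
qed

theorem welfare_eq_policy_value:
  assumes "algorithm I p"
  shows "welfare I p = policy_value I P p u"
  using expectation_payoff[of "{}" p u] assms
  by (simp add: welfare_eq_expectation algorithm_iff)

text \<open>
  On the finitely many value profiles of positive probability, there are only finitely many
  behaviours of a policy, hence only finitely many welfares.
\<close>

theorem optimal_exists: "\<exists>opt. optimal I opt"
proof -
  define W where "W = welfare I ` {p. algorithm I p}"
  define F where "F = PiE (set_pmf V) (\<lambda>_. Pow (boxes I) \<times> Pow (edges I))"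
  define G where "G g = measure_pmf.expectation V (\<lambda>v. \<Sum>(i, j)\<in>boxes I.
       of_bool ({i, j} \<in> snd (g v)) * v (i, j)
       - of_bool ((i, j) \<in> fst (g v)) * box_cost I (i, j))"
    for g :: "(nat \<times> nat \<Rightarrow> real) \<Rightarrow> (nat \<times> nat) set \<times> nat set set"
  have "W \<subseteq> G ` F"
  proof
    fix w assume "w \<in> W"
    then obtain p where p: "algorithm I p" "w = welfare I p"
      by (auto simp: W_def)
    let ?g = "\<lambda>v\<in>set_pmf V. (opened p v, outcome p v)"
    have "w = G ?g"
      unfolding p(2) welfare_eq_expectation[OF p(1)] G_def
      by (rule integral_cong_AE) (auto simp: AE_measure_pmf_iff payoff_def)
    moreover have "?g \<in> F"
      using p(1) opened_disjoint[of I "{}" p] outcome_subset_edges[of I "{}" p]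
      by (auto simp: F_def algorithm_iff)
    ultimately show "w \<in> G ` F"
      by blast
  qed
  moreover have "finite F"
    unfolding F_def using finite_set_V finite_boxes finite_edges by (auto intro!: finite_PiE)
  ultimately have "finite W"
    by (auto intro: finite_subset)
  moreover have "algorithm I (Stop {})"
    by (simp add: algorithm_def matching_def)
  then have "W \<noteq> {}"
    by (auto simp: W_def)
  ultimately have "Max W \<in> W" and ge: "\<forall>w\<in>W. w \<le> Max W"
    by auto
  then show ?thesis
    by (auto simp: W_def optimal_def)
qed

lemma measurable_policy_Stop: "measurable_policy I (Stop M)"
  by (simp add: measurable_policy_def)

lemma measurable_policy_branch:
  assumes b: "b \<in> boxes I" and "measurable_policy I p" "measurable_policy I q"
  shows "measurable_policy I (branch b t p q)"
proof -
  note [measurable] = measurable_component_value_space[OF b]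
  have mem: "c \<in> opened (branch b t p q) v \<longleftrightarrow>
      c = b \<or> (v b = t \<and> c \<in> opened p v \<or> v b \<noteq> t \<and> c \<in> opened q v)"
    "e \<in> outcome (branch b t p q) v \<longleftrightarrow>
      (v b = t \<and> e \<in> outcome p v \<or> v b \<noteq> t \<and> e \<in> outcome q v)" for c e v
    by (auto simp: branch_def)
  show ?thesis
    unfolding measurable_policy_def mem
  proof (intro conjI ballI)
    fix c assume "c \<in> boxes I"
    then have [measurable]: "Measurable.pred (value_space I) (\<lambda>v. c \<in> opened p v)"
        "Measurable.pred (value_space I) (\<lambda>v. c \<in> opened q v)"
      using assms(2,3) by (auto simp: measurable_policy_def)
    show "Measurable.pred (value_space I)
        (\<lambda>v. c = b \<or> v b = t \<and> c \<in> opened p v \<or> v b \<noteq> t \<and> c \<in> opened q v)"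
      by measurable
  next
    fix e assume "e \<in> edges I"
    then have [measurable]: "Measurable.pred (value_space I) (\<lambda>v. e \<in> outcome p v)"
        "Measurable.pred (value_space I) (\<lambda>v. e \<in> outcome q v)"
      using assms(2,3) by (auto simp: measurable_policy_def)
    show "Measurable.pred (value_space I)
        (\<lambda>v. v b = t \<and> e \<in> outcome p v \<or> v b \<noteq> t \<and> e \<in> outcome q v)"
      by measurable
  qed
qed

section \<open>Upper bounds by potentials\<close>

text \<open>A supermartingale argument: no opening raises the expected potential net of costs, and
  at a stop the potential dominates the value of the matching. The orientation \<open>R\<close>
  restricts the openings to be checked.\<close>

lemma policy_value_le_potential:
  fixes \<Phi> :: "(nat \<times> nat) set \<Rightarrow> (nat \<times> nat \<Rightarrow> real) \<Rightarrow> real"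
  assumes stop: "\<And>M S u. matching I M \<Longrightarrow> (\<And>i j. {i, j} \<in> M \<Longrightarrow> (i, j) \<in> S \<and> (j, i) \<in> S) \<Longrightarrow>
      (\<And>c. c \<in> S \<Longrightarrow> u c \<in> set_pmf (P c)) \<Longrightarrow>
      (\<Sum>(i, j)\<in>boxes I. of_bool ({i, j} \<in> M) * u (i, j)) \<le> \<Phi> S u"
    and opn: "\<And>b S u. b \<in> boxes I \<Longrightarrow> b \<notin> S \<Longrightarrow>
      ((snd b, fst b) \<in> R \<Longrightarrow> (snd b, fst b) \<in> S) \<Longrightarrow>
      (\<And>c. c \<in> S \<Longrightarrow> u c \<in> set_pmf (P c)) \<Longrightarrow>
      measure_pmf.expectation (P b) (\<lambda>x. \<Phi> (insert b S) (u(b := x))) - box_cost I b \<le> \<Phi> S u"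
    and "feasible I S p" "oriented R S p" "\<And>c. c \<in> S \<Longrightarrow> u c \<in> set_pmf (P c)"
  shows "policy_value I P p u \<le> \<Phi> S u"
  using assms(3-5)
proof (induction p arbitrary: S u)
  case (Stop M)
  then show ?case
    by (auto intro!: stop)
next
  case (Open b k)
  then have b: "b \<in> boxes I" "b \<notin> S" "(snd b, fst b) \<in> R \<Longrightarrow> (snd b, fst b) \<in> S"
    and k: "\<And>x. feasible I (insert b S) (k x)" "\<And>x. oriented R (insert b S) (k x)"
    by auto
  have "policy_value I P (k x) (u(b := x)) \<le> \<Phi> (insert b S) (u(b := x))" if "x \<in> set_pmf (P b)" for x
    using that Open.prems(3) by (intro Open.IH[OF rangeI] k) auto
  then have "measure_pmf.expectation (P b) (\<lambda>x. policy_value I P (k x) (u(b := x)))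
      \<le> measure_pmf.expectation (P b) (\<lambda>x. \<Phi> (insert b S) (u(b := x)))"
    by (intro integral_mono_AE integrable_measure_pmf_finite finite_support b)
       (auto simp: AE_measure_pmf_iff)
  then show ?case
    using opn[of b S u] b Open.prems(3) by fastforce
qed

end

section \<open>Stars\<close>

definition prize_pmf :: "real \<Rightarrow> real pmf" where
  "prize_pmf p = map_pmf (\<lambda>s. if s then 1 / p else 0) (bernoulli_pmf p)"

definition veto_pmf :: "real \<Rightarrow> real pmf" where
  "veto_pmf p = map_pmf (\<lambda>s. if s then 1 else - (1 / p)) (bernoulli_pmf (1 / 2))"

definition star_pmf :: "real \<Rightarrow> nat \<times> nat \<Rightarrow> real pmf" where
  "star_pmf p b = (if fst b = 0 then prize_pmf p else veto_pmf p)"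

definition star :: "nat \<Rightarrow> real \<Rightarrow> real \<Rightarrow> pandora" where
  "star n p \<delta> = \<lparr>verts = {0..n}, edges = (\<lambda>i. {0, i}) ` {1..n},
     box_dist = (\<lambda>b. distr (measure_pmf (star_pmf p b)) borel (\<lambda>x. x)),
     box_cost = (\<lambda>b. if fst b = 0 then (1 - \<delta>) / 2 else 1 / 2)\<rparr>"

locale pandora_star =
  fixes n :: nat and p \<delta> :: real
  assumes p: "0 < p" "p \<le> 1" and \<delta>: "0 < \<delta>" "\<delta> \<le> 1"
begin

abbreviation "\<S> \<equiv> star n p \<delta>"

lemma box_cost_star [simp]:
  "box_cost \<S> (0, i) = (1 - \<delta>) / 2" "i \<noteq> 0 \<Longrightarrow> box_cost \<S> (i, j) = 1 / 2"
  by (simp_all add: star_def)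

lemma star_pmf_simps [simp]:
  "star_pmf p (0, i) = prize_pmf p" "i \<noteq> 0 \<Longrightarrow> star_pmf p (i, j) = veto_pmf p"
  by (simp_all add: star_pmf_def)

lemma boxes_star: "boxes \<S> = Pair 0 ` {1..n} \<union> (\<lambda>i. (i, 0)) ` {1..n}"
  by (auto simp: boxes_def star_def doubleton_eq_iff)

lemma sum_boxes_star: "(\<Sum>b\<in>boxes \<S>. f b) = (\<Sum>i\<in>{1..n}. f (0, i) + f (i, 0))"
  unfolding boxes_star
  by (subst sum.union_disjoint) (auto simp: sum.reindex inj_on_def sum.distrib)

lemma set_prize_pmf: "set_pmf (prize_pmf p) \<subseteq> {0, 1 / p}"
  by (auto simp: prize_pmf_def)

lemma set_veto_pmf: "set_pmf (veto_pmf p) \<subseteq> {1, - (1 / p)}"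
  by (auto simp: veto_pmf_def)

lemma expectation_prize [simp]:
  fixes f :: "real \<Rightarrow> real"
  shows "measure_pmf.expectation (prize_pmf p) f = f (1 / p) * p + f 0 * (1 - p)"
  using p by (simp add: prize_pmf_def)

lemma expectation_veto [simp]:
  fixes f :: "real \<Rightarrow> real"
  shows "measure_pmf.expectation (veto_pmf p) f = f 1 / 2 + f (- (1 / p)) / 2"
  by (simp add: veto_pmf_def)

lemma finite_set_star_pmf: "finite (set_pmf (star_pmf p b))"
  by (simp add: star_pmf_def prize_pmf_def veto_pmf_def)

lemma pandora_instance_star: "pandora_instance \<S>"
proof -
  have "prob_space (distr (measure_pmf (star_pmf p b)) borel (\<lambda>x::real. x))" for b
    by (rule prob_space.prob_space_distr) (auto intro: measure_pmf.prob_space_axioms)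
  moreover have "integrable (distr (measure_pmf (star_pmf p b)) borel (\<lambda>x::real. x)) (\<lambda>x. x)" for b
    by (subst integrable_distr_eq) (auto intro: integrable_measure_pmf_finite finite_set_star_pmf)
  ultimately show ?thesis
    using \<delta> by (auto simp: pandora_instance_def star_def)
qed

sublocale discrete_pandora \<S> "star_pmf p"
  using pandora_instance_star finite_set_star_pmf by unfold_locales (simp_all add: star_def)

text \<open>All edges share the centre, so distinct edges are never disjoint.\<close>

lemma matching_star:
  assumes "matching \<S> M"
  shows "M = {} \<or> (\<exists>i\<in>{1..n}. M = {{0, i}})"
proof (cases "M = {}")
  case False
  then obtain e where e: "e \<in> M"
    by blast
  have sub: "M \<subseteq> (\<lambda>i. {0, i}) ` {1..n}" and dis: "pairwise disjnt M"
    using assms by (auto simp: matching_def star_def)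
  have "e' = e" if "e' \<in> M" for e'
  proof (rule ccontr)
    assume "e' \<noteq> e"
    then have "disjnt e' e"
      using dis e that by (auto simp: pairwise_def)
    moreover have "0 \<in> e" "0 \<in> e'"
      using sub e that by auto
    ultimately show False
      by (auto simp: disjnt_def)
  qed
  then have "M = {e}"
    using e by blast
  then show ?thesis
    using sub by auto
qed simp

text \<open>
  The potential is \<open>z\<close> plus a sum over the leaves of a function \<open>f\<close> of the observed contents of the
  two boxes of the edge (\<open>None\<close> for an unopened box); \<open>z\<close> is a price that the matched edge has
  to pay for the use of the centre.
\<close>

lemma policy_value_star_le:
  fixes f :: "real option \<Rightarrow> real option \<Rightarrow> real"
  assumes z: "z \<ge> 0" and f: "\<And>x y. f x y \<ge> 0"
    and stop: "\<And>a b. a + b \<le> z + f (Some a) (Some b)"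
    and prize: "\<And>y i. i \<in> {1..n} \<Longrightarrow> ((i, 0) \<in> R \<Longrightarrow> y \<noteq> None) \<Longrightarrow>
      y \<in> {None, Some 1, Some (- (1 / p))} \<Longrightarrow>
      f (Some (1 / p)) y * p + f (Some 0) y * (1 - p) - (1 - \<delta>) / 2 \<le> f None y"
    and veto: "\<And>x i. i \<in> {1..n} \<Longrightarrow> ((0, i) \<in> R \<Longrightarrow> x \<noteq> None) \<Longrightarrow>
      x \<in> {None, Some 0, Some (1 / p)} \<Longrightarrow>
      f x (Some 1) / 2 + f x (Some (- (1 / p))) / 2 - 1 / 2 \<le> f x None"
    and q: "feasible \<S> {} q" "oriented R {} q"
  shows "policy_value \<S> (star_pmf p) q u \<le> z + real n * f None None"
proof -
  define st where "st S u b = (if b \<in> S then Some (u b) else None)"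
    for S and u :: "nat \<times> nat \<Rightarrow> real" and b
  define g where "g S u i = f (st S u (0, i)) (st S u (i, 0))" for S u and i :: nat
  define \<Phi> where "\<Phi> S u = z + (\<Sum>i\<in>{1..n}. g S u i)" for S u
  have upd: "\<Phi> (insert b S) (u(b := x)) = \<Phi> S u - g S u i + g (insert b S) (u(b := x)) i"
    if "i \<in> {1..n}" "b = (0, i) \<or> b = (i, 0)" for b S u x i
  proof -
    have "(\<Sum>j\<in>{1..n} - {i}. g (insert b S) (u(b := x)) j) = (\<Sum>j\<in>{1..n} - {i}. g S u j)"
      using that by (intro sum.cong refl) (auto simp: g_def st_def)
    then show ?thesis
      unfolding \<Phi>_def sum.remove[OF finite_atLeastAtMost that(1)] by simp
  qed
  have "policy_value \<S> (star_pmf p) q u \<le> \<Phi> {} u"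
  proof (rule policy_value_le_potential[where R = R])
    fix M S u
    assume M: "matching \<S> M" "\<And>i j. {i, j} \<in> M \<Longrightarrow> (i, j) \<in> S \<and> (j, i) \<in> S"
    have nonneg: "g S u i \<ge> 0" for i
      by (simp add: g_def f)
    show "(\<Sum>(i, j)\<in>boxes \<S>. of_bool ({i, j} \<in> M) * u (i, j)) \<le> \<Phi> S u"
    proof (cases "M = {}")
      case True
      then show ?thesis
        using z nonneg by (simp add: \<Phi>_def sum_nonneg)
    next
      case False
      then obtain i where i: "i \<in> {1..n}" "M = {{0, i}}"
        using matching_star[OF M(1)] by blast
      have "(\<Sum>(i, j)\<in>boxes \<S>. of_bool ({i, j} \<in> M) * u (i, j)) =
          (\<Sum>j\<in>{1..n}. if j = i then u (0, i) + u (i, 0) else 0)"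
        unfolding sum_boxes_star using i by (intro sum.cong refl) (auto simp: doubleton_eq_iff)
      also have "\<dots> = u (0, i) + u (i, 0)"
        using i(1) by simp
      \<comment> \<open>Both boxes of a matched edge have been opened, so \<open>stop\<close>
        applies; the other leaves only add nonnegative terms.\<close>
      also have "\<dots> \<le> z + g S u i"
        using M(2)[of 0 i] i by (simp add: g_def st_def stop)
      also have "\<dots> \<le> \<Phi> S u"
        unfolding \<Phi>_def using i nonneg by (simp add: member_le_sum)
      finally show ?thesis .
    qed
  next
    fix b S u
    assume b: "b \<in> boxes \<S>" "b \<notin> S" "(snd b, fst b) \<in> R \<Longrightarrow> (snd b, fst b) \<in> S"
      and supp: "\<And>c. c \<in> S \<Longrightarrow> u c \<in> set_pmf (star_pmf p c)"
    obtain i where i: "i \<in> {1..n}" "b = (0, i) \<or> b = (i, 0)"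
      using b(1) by (auto simp: boxes_star)
    let ?E = "measure_pmf.expectation (star_pmf p b)"
    have "?E (\<lambda>x. \<Phi> (insert b S) (u(b := x))) =
        \<Phi> S u - g S u i + ?E (\<lambda>x. g (insert b S) (u(b := x)) i)"
      unfolding upd[OF i] by (simp add: integrable_measure_pmf_finite finite_set_star_pmf)
    moreover have "?E (\<lambda>x. g (insert b S) (u(b := x)) i) - box_cost \<S> b \<le> g S u i"
      using i(2)
    proof
      assume [simp]: "b = (0, i)"
      have "st S u (i, 0) \<in> {None, Some 1, Some (- (1 / p))}"
        using supp[of "(i, 0)"] set_veto_pmf i by (auto simp: st_def)
      moreover have "st S u (i, 0) \<noteq> None" if "(i, 0) \<in> R"
        using b(3) that by (simp add: st_def)
      ultimately show ?thesis
        using prize[OF i(1), of "st S u (i, 0)"] b i by (auto simp: g_def st_def)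
    next
      assume [simp]: "b = (i, 0)"
      have "st S u (0, i) \<in> {None, Some 0, Some (1 / p)}"
        using supp[of "(0, i)"] set_prize_pmf i by (auto simp: st_def)
      moreover have "st S u (0, i) \<noteq> None" if "(0, i) \<in> R"
        using b(3) that by (simp add: st_def)
      ultimately show ?thesis
        using veto[OF i(1), of "st S u (0, i)"] b i by (auto simp: g_def st_def)
    qed
    ultimately show "?E (\<lambda>x. \<Phi> (insert b S) (u(b := x))) - box_cost \<S> b \<le> \<Phi> S u"
      by simp
  qed (use q in auto)
  then show ?thesis
    by (simp add: \<Phi>_def g_def st_def)
qed

section \<open>Upper bounds for the two directions\<close>

text \<open>With price \<open>0\<close> for the centre the leaves decouple, and each contributes at
  most \<open>\<delta> / 2\<close>.\<close>

lemma prize_first_le: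
  assumes q: "algorithm \<S> q" "oriented R {} q" and R: "\<And>i. i \<in> {1..n} \<Longrightarrow> (0, i) \<in> R"
  shows "welfare \<S> q \<le> real n * \<delta> / 2"
proof -
  \<comment> \<open>After a prize value \<open>a\<close>, opening the veto box is worth
    \<open>a / 2\<close> for both possible \<open>a\<close>; hence a fresh edge is worth
    \<open>p * (1 / p) / 2 - (1 - \<delta>) / 2 = \<delta> / 2\<close>. The value \<open>2\<close>
    belongs to states that this direction excludes and is large enough for
    \<open>prize\<close>.\<close>
  define f where "f x y = (case x of
      None \<Rightarrow> (case y of None \<Rightarrow> \<delta> / 2 | Some b \<Rightarrow> 2)
    | Some a \<Rightarrow> (case y of None \<Rightarrow> max 0 (a / 2) | Some b \<Rightarrow> max 0 (a + b)))" for x y :: "real option"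
  have "policy_value \<S> (star_pmf p) q (\<lambda>_. 0) \<le> 0 + real n * f None None"
  proof (rule policy_value_star_le[where R = R and f = f])
    show "f x y \<ge> 0" for x y
      using \<delta> by (auto simp: f_def split: option.splits)
    show "a + b \<le> 0 + f (Some a) (Some b)" for a b
      by (simp add: f_def)
    show "f (Some (1 / p)) y * p + f (Some 0) y * (1 - p) - (1 - \<delta>) / 2 \<le> f None y"
      if "y \<in> {None, Some 1, Some (- (1 / p))}" for y
      using that p \<delta> by (auto simp: f_def field_simps max_def)
    show "f x (Some 1) / 2 + f x (Some (- (1 / p))) / 2 - 1 / 2 \<le> f x None"
      if "i \<in> {1..n}" "(0, i) \<in> R \<Longrightarrow> x \<noteq> None" "x \<in> {None, Some 0, Some (1 / p)}" for x i
      using that R[of i] p by (auto simp: f_def field_simps max_def)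
  qed (use q in \<open>auto simp: algorithm_iff\<close>)
  then show ?thesis
    using q welfare_eq_policy_value by (simp add: f_def)
qed

text \<open>The price \<open>1\<close> for the centre cancels the veto value \<open>1\<close>. The
  prize that remains does not pay for a veto box, as
  \<open>(1 + \<delta>) / 4 - 1 / 2 \<le> 0\<close>; so the leaves add nothing to the price.\<close>

lemma veto_first_le:
  assumes q: "algorithm \<S> q" "oriented R {} q" and R: "\<And>i. i \<in> {1..n} \<Longrightarrow> (i, 0) \<in> R"
  shows "welfare \<S> q \<le> 1"
proof -
  \<comment> \<open>\<open>(1 + \<delta>) / 2\<close> is the expected prize
    \<open>p * (1 / p)\<close> minus the cost of its box. The value \<open>1 / p\<close> belongs to
    states that this direction excludes and is large enough for \<open>veto\<close>.\<close>
  define f where "f x y = (case x of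
      None \<Rightarrow> (case y of None \<Rightarrow> 0 | Some b \<Rightarrow> if b = 1 then (1 + \<delta>) / 2 else 0)
    | Some a \<Rightarrow> (case y of None \<Rightarrow> 1 / p | Some b \<Rightarrow> max 0 (a + b - 1)))" for x y :: "real option"
  have "policy_value \<S> (star_pmf p) q (\<lambda>_. 0) \<le> 1 + real n * f None None"
  proof (rule policy_value_star_le[where R = R and f = f])
    show "f x y \<ge> 0" for x y
      using \<delta> p by (auto simp: f_def split: option.splits)
    show "a + b \<le> 1 + f (Some a) (Some b)" for a b
      by (simp add: f_def)
    show "f (Some (1 / p)) y * p + f (Some 0) y * (1 - p) - (1 - \<delta>) / 2 \<le> f None y"
      if "i \<in> {1..n}" "(i, 0) \<in> R \<Longrightarrow> y \<noteq> None" "y \<in> {None, Some 1, Some (- (1 / p))}" for y i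
      using that R[of i] p \<delta> by (auto simp: f_def field_simps max_def)
    show "f x (Some 1) / 2 + f x (Some (- (1 / p))) / 2 - 1 / 2 \<le> f x None"
      if "x \<in> {None, Some 0, Some (1 / p)}" for x
      using that p \<delta> by (auto simp: f_def field_simps max_def)
  qed (use q in \<open>auto simp: algorithm_iff\<close>)
  then show ?thesis
    using q welfare_eq_policy_value by (simp add: f_def)
qed

section \<open>Lower bounds for the optimum\<close>

lemma feasible_edge:
  assumes "i \<in> {1..n}" "(0, i) \<in> S" "(i, 0) \<in> S"
  shows "feasible \<S> S (Stop {{0, i}})"
  using assms by (auto simp: matching_def star_def doubleton_eq_iff)

lemma feasible_empty: "feasible \<S> S (Stop {})"
  by (simp add: matching_def)

lemma policy_value_edge:
  assumes "i \<in> {1..n}"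
  shows "policy_value \<S> (star_pmf p) (Stop {{0, i}}) u = u (0, i) + u (i, 0)"
proof -
  have "policy_value \<S> (star_pmf p) (Stop {{0, i}}) u =
      (\<Sum>j\<in>{1..n}. if j = i then u (0, i) + u (i, 0) else 0)"
    unfolding policy_value.simps sum_boxes_star
    using assms by (intro sum.cong refl) (auto simp: doubleton_eq_iff)
  then show ?thesis
    using assms by simp
qed

lemma policy_value_empty: "policy_value \<S> (star_pmf p) (Stop {}) u = 0"
  by (auto intro!: sum.neutral)

lemma policy_value_le_optimal: "optimal \<S> opt \<Longrightarrow> algorithm \<S> q \<Longrightarrow>
    policy_value \<S> (star_pmf p) q u \<le> welfare \<S> opt"
  by (metis optimal_def welfare_eq_policy_value)

lemma optimal_ge_veto_first:
  assumes "n \<ge> 1" "optimal \<S> opt"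
  shows "(1 + \<delta>) / 4 \<le> welfare \<S> opt"
proof -
  \<comment> \<open>With veto value \<open>1\<close> the edge is taken whatever the prize is; so
    both subtrees agree and the test value \<open>0\<close> is arbitrary. The value of
    \<open>q\<close> is \<open>(2 - (1 - \<delta>) / 2) / 2 - 1 / 2\<close>.\<close>
  define r where "r = branch (0, 1) 0 (Stop {{0, 1}}) (Stop {{0, 1}})"
  define q where "q = branch (1, 0) 1 r (Stop {})"
  have one: "1 \<in> {1..n}"
    using assms by simp
  have bx: "(0, 1) \<in> boxes \<S>" "(1, 0) \<in> boxes \<S>"
    using one by (auto simp: boxes_star)
  have "feasible \<S> {} q"
    unfolding q_def r_def branch_def
    using bx feasible_edge[OF one] by (simp add: feasible_empty del: feasible.simps(1))
  moreover have "measurable_policy \<S> q"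
    unfolding q_def r_def by (intro measurable_policy_branch measurable_policy_Stop bx)
  \<comment> \<open>The simplifier turns \<open>1\<close> into \<open>Suc 0\<close>, so the value of
    the edge is restated in that form.\<close>
  moreover have "policy_value \<S> (star_pmf p) (Stop {{0, Suc 0}}) u = u (0, Suc 0) + u (Suc 0, 0)" for u
    using policy_value_edge[OF one] by (simp del: policy_value.simps(1))
  then have "policy_value \<S> (star_pmf p) q (\<lambda>_. 0) = (1 + \<delta>) / 4"
    unfolding q_def r_def branch_def using p
    by (simp add: policy_value_empty field_simps
        del: policy_value.simps(1))
  ultimately show ?thesis
    using policy_value_le_optimal[OF assms(2), of q "\<lambda>_. 0"] by (simp add: algorithm_iff)
qed

text \<open>Leaves are tried downwards from \<open>m\<close>. The search ends at the first prize
  even if it is vetoed, which makes the values a geometric recursion.\<close>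

primrec probe :: "nat \<Rightarrow> policy" where
  "probe 0 = Stop {}"
| "probe (Suc m) = branch (0, Suc m) (1 / p)
     (branch (Suc m, 0) 1 (Stop {{0, Suc m}}) (Stop {})) (probe m)"

text \<open>\<open>S\<close> is general because the prize boxes of leaves beyond \<open>m\<close>
  are already open when the recursion reaches \<open>m\<close>; they lie outside the square.\<close>

lemma feasible_probe:
  assumes "m \<le> n" "S \<inter> {0..m} \<times> {0..m} = {}"
  shows "feasible \<S> S (probe m)"
  using assms
proof (induction m arbitrary: S)
  case 0
  then show ?case
    by (simp add: matching_def)
next
  case (Suc m)
  have m: "Suc m \<in> {1..n}"
    using Suc.prems by simp
  have "feasible \<S> (insert (0, Suc m) S) (probe m)"
    using Suc.prems by (intro Suc.IH) auto
  moreover have "(0, Suc m) \<in> boxes \<S>" "(Suc m, 0) \<in> boxes \<S>"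
    using m by (auto simp: boxes_star)
  moreover have "(0, Suc m) \<notin> S" "(Suc m, 0) \<notin> S"
    using Suc.prems by auto
  ultimately show ?case
    using feasible_edge[OF m] by (simp add: branch_def feasible_empty del: feasible.simps(1))
qed

lemma measurable_probe: "m \<le> n \<Longrightarrow> measurable_policy \<S> (probe m)"
  by (induction m)
     (auto intro!: measurable_policy_branch measurable_policy_Stop simp: boxes_star)

text \<open>A prize is worth \<open>(1 / p + 1) / 2 - 1 / 2 = 1 / (2 * p)\<close>, so a trial adds
  \<open>1 / 2 - (1 - \<delta>) / 2 = \<delta> / 2\<close>, and the search continues with
  probability \<open>1 - p\<close>: a geometric sum.\<close>

lemma policy_value_probe:
  "m \<le> n \<Longrightarrow> policy_value \<S> (star_pmf p) (probe m) u = \<delta> / (2 * p) * (1 - (1 - p) ^ m)"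
proof (induction m arbitrary: u)
  case 0
  then show ?case
    by (simp add: policy_value_empty del: policy_value.simps(1))
next
  case (Suc m)
  then have m: "Suc m \<in> {1..n}"
    by simp
  have "policy_value \<S> (star_pmf p) (probe (Suc m)) u =
      (1 / p) / 2 * p + \<delta> / (2 * p) * (1 - (1 - p) ^ m) * (1 - p) - (1 - \<delta>) / 2"
    using Suc p by (simp add: branch_def policy_value_edge[OF m] policy_value_empty
        add_divide_distrib del: policy_value.simps(1))
  also have "\<dots> = \<delta> / (2 * p) * (1 - (1 - p) ^ Suc m)"
    using p by (simp add: field_simps)
  finally show ?case .
qed

lemma optimal_ge_prize_first:
  assumes "optimal \<S> opt"
  shows "\<delta> / (2 * p) * (1 - (1 - p) ^ n) \<le> welfare \<S> opt"
proof -
  have "algorithm \<S> (probe n)"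
    by (simp add: algorithm_iff feasible_probe measurable_probe)
  then show ?thesis
    using policy_value_le_optimal[OF assms, of "probe n" "\<lambda>_. 0"] by (simp add: policy_value_probe)
qed

section \<open>Choice of the instance\<close>

text \<open>All edges carry the same parameters, so one truth value directs them all. It does not
  involve \<open>n\<close>, which may thus be chosen once it is known.\<close>

lemma orientation_star:
  assumes "orientation \<S> R" "obeys_rule rule \<S> R"
  defines "D \<equiv> \<lambda>X. distr (measure_pmf X) borel (\<lambda>x::real. x)"
  shows "(\<forall>i\<in>{1..n}. if rule (D (prize_pmf p)) ((1 - \<delta>) / 2) (D (veto_pmf p)) (1 / 2)
      then (0, i) \<in> R else (i, 0) \<in> R)"
proof
  fix i assume i: "i \<in> {1..n}"
  then have bx: "(0, i) \<in> boxes \<S>"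
    by (auto simp: boxes_star)
  have bd: "box_dist \<S> b = D (star_pmf p b)" for b
    by (simp add: star_def D_def)
  \<comment> \<open>Since \<open>\<delta> > 0\<close>, the two costs differ, so
    \<open>obeys_rule\<close> is binding at this edge.\<close>
  have "(0, i) \<in> R \<longleftrightarrow> rule (D (prize_pmf p)) ((1 - \<delta>) / 2) (D (veto_pmf p)) (1 / 2)"
    using assms(2) bx i \<delta> by (fastforce simp: obeys_rule_def bd)
  moreover have "(0, i) \<in> R \<longleftrightarrow> (i, 0) \<notin> R"
    using assms(1) bx by (auto simp: orientation_def)
  ultimately show "if rule (D (prize_pmf p)) ((1 - \<delta>) / 2) (D (veto_pmf p)) (1 / 2)
      then (0, i) \<in> R else (i, 0) \<in> R"
    by presburger
qed

end

theorem theorem3: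
  fixes alg :: "pandora \<Rightarrow> policy" and \<alpha> :: real
  assumes "edge_based_fixed_orientation alg" and "\<alpha> > 0"
  shows "\<exists>I opt. pandora_instance I \<and> optimal I opt \<and> welfare I (alg I) < \<alpha> * welfare I opt"
proof -
  obtain rule where rule: "\<And>I. pandora_instance I \<Longrightarrow> algorithm I (alg I) \<and>
      (\<exists>R. orientation I R \<and> obeys_rule rule I R \<and> oriented R {} (alg I))"
    using assms(1) by (auto simp: edge_based_fixed_orientation_def)
  \<comment> \<open>This makes \<open>\<delta> / 2 < \<alpha> / 4\<close>, which settles the
    prize-first case.\<close>
  define \<delta> where "\<delta> = min 1 (\<alpha> / 4)"
  \<comment> \<open>This makes \<open>\<alpha> * \<delta> / (4 * p) \<ge> 2\<close>, which beats the
    bound \<open>1\<close> of the veto-first case.\<close>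
  define p where "p = min (1 / 2) (\<alpha> * \<delta> / 8)"
  have \<delta>_bounds: "0 < \<delta>" "\<delta> \<le> 1" "\<delta> \<le> \<alpha> / 4"
    using assms(2) by (auto simp: \<delta>_def)
  have p_bounds: "0 < p" "p < 1" "p \<le> \<alpha> * \<delta> / 8"
    using assms(2) \<delta>_bounds by (auto simp: p_def)
  \<comment> \<open>The locale predicate has no argument for the number of leaves, so one fact
    serves both interpretations.\<close>
  have star: "pandora_star p \<delta>"
    using p_bounds \<delta>_bounds by unfold_locales auto
  define D where "D = (\<lambda>X. distr (measure_pmf X) borel (\<lambda>x::real. x))"
  show ?thesis
  proof (cases "rule (D (prize_pmf p)) ((1 - \<delta>) / 2) (D (veto_pmf p)) (1 / 2)")
    case True
    let ?I = "star 1 p \<delta>"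
    interpret pandora_star 1 p \<delta>
      by (rule star)
    obtain opt where opt: "optimal ?I opt"
      using optimal_exists by blast
    obtain R where R: "orientation ?I R" "obeys_rule rule ?I R" "oriented R {} (alg ?I)"
      using rule[OF pandora_instance_star] by blast
    have "welfare ?I (alg ?I) \<le> real 1 * \<delta> / 2"
      using rule[OF pandora_instance_star] orientation_star[OF R(1,2)] True R(3)
      by (intro prize_first_le[of _ R]) (auto simp: D_def)
    also have "\<dots> < \<alpha> * (1 / 4)"
      using \<delta>_bounds assms(2) by simp
    also have "\<dots> \<le> \<alpha> * welfare ?I opt"
      using optimal_ge_veto_first[OF _ opt] \<delta>_bounds assms(2) by (intro mult_left_mono) auto
    finally show ?thesis
      using opt pandora_instance_star by blast
  next
    case False
    \<comment> \<open>With this many leaves the search fails with probability below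
      \<open>1 / 2\<close> and earns at least half of \<open>\<delta> / (2 * p)\<close>.\<close>
    obtain n where n: "(1 - p) ^ n < 1 / 2"
      using real_arch_pow_inv[of "1 / 2" "1 - p"] p_bounds by auto
    let ?I = "star n p \<delta>"
    interpret pandora_star n p \<delta>
      by (rule star)
    obtain opt where opt: "optimal ?I opt"
      using optimal_exists by blast
    obtain R where R: "orientation ?I R" "obeys_rule rule ?I R" "oriented R {} (alg ?I)"
      using rule[OF pandora_instance_star] by blast
    have "welfare ?I (alg ?I) \<le> 1"
      using rule[OF pandora_instance_star] orientation_star[OF R(1,2)] False R(3)
      by (intro veto_first_le[of _ R]) (auto simp: D_def)
    also have "1 < \<alpha> * (\<delta> / (2 * p) * (1 / 2))"
      using p_bounds \<delta>_bounds assms(2) by (simp add: field_simps)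
    also have "\<dots> \<le> \<alpha> * (\<delta> / (2 * p) * (1 - (1 - p) ^ n))"
      using n p_bounds \<delta>_bounds assms(2) by (intro mult_left_mono) auto
    also have "\<dots> \<le> \<alpha> * welfare ?I opt"
      using optimal_ge_prize_first[OF opt] assms(2) by (intro mult_left_mono) auto
    finally show ?thesis
      using opt pandora_instance_star by blast
  qed
qed

end
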